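(* Let $k\ge 1$ and suppose $\Pi$ is a $k$-path in a diagram $D$. Then $\Pi$ is equivalent to an ordered $k$-path in $D$; that is, there is an ordered $k$-path in $D$ with the same support as $\Pi$.
   Context: A diagram $D$ is a non-empty finite subset of $\mathbb{Z}^2$ whose elements (nodes) are written $(a,b)$, with $a$ the row index and $b$ the column index (rows indexed from top to bottom, columns from left to right); it has no empty rows or columns, and both rows and columns are indexed consecutively from $1$. A path of length $m$ in $D$ is a non-empty sequence of nodes $((a_i,b_i))_{i=1}^m$ of $D$ with $a_i<a_{i+1}$ and $b_i\le b_{i+1}$ for $1\le i\le m-1$. A $k$-path in $D$ is a sequence of $k$ mutually disjoint paths in $D$ (its constituent paths). The support $s(\Pi)$ of a $k$-path $\Pi$ is the set of nodes occurring in its paths. A $k$-path and a $k'$-path in $D$ are equivalent if they have the same support. For non-empty subsets $D_1,D_2$ of $D$, write $D_1\prec D_2$ if whenever $(a_1,b_1)\in D_1$ and $(a_2,b_2)\in D_2$ with $a_1\le a_2$, then $b_1<b_2$. A $k$-path $\Pi=(\pi_1,\ldots,\pi_k)$ is ordered if $s(\pi_i)\prec s(\pi_j)$ whenever $1\le i<j\le k$. *)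

theory Defs
  imports Main
begin

text \<open>A node \<open>(a, b)\<close> has row index \<open>a\<close> (rows run from top to bottom) and column index \<open>b\<close>.\<close>

type_synonym node = "int \<times> int"

text \<open>The two existential clauses say that the non-empty rows are exactly \<open>1, \<dots>, r\<close> and the
  non-empty columns exactly \<open>1, \<dots>, c\<close>.\<close>

definition diagram :: "node set \<Rightarrow> bool" where
  "diagram D \<longleftrightarrow> finite D \<and> D \<noteq> {} \<and> (\<exists>r. fst ` D = {1..r}) \<and> (\<exists>c. snd ` D = {1..c})"

definition is_path :: "node set \<Rightarrow> node list \<Rightarrow> bool" where
  "is_path D p \<longleftrightarrow> p \<noteq> [] \<and> set p \<subseteq> D \<and>
     (\<forall>i. Suc i < length p \<longrightarrow>
        fst (p ! i) < fst (p ! Suc i) \<and> snd (p ! i) \<le> snd (p ! Suc i))"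

definition k_path :: "node set \<Rightarrow> nat \<Rightarrow> node list list \<Rightarrow> bool" where
  "k_path D k \<Pi> \<longleftrightarrow> length \<Pi> = k \<and> (\<forall>p \<in> set \<Pi>. is_path D p) \<and>
     (\<forall>i j. i < j \<and> j < k \<longrightarrow> set (\<Pi> ! i) \<inter> set (\<Pi> ! j) = {})"

definition support :: "node list list \<Rightarrow> node set" where
  "support \<Pi> = (\<Union>p \<in> set \<Pi>. set p)"

definition path_equiv :: "node list list \<Rightarrow> node list list \<Rightarrow> bool" where
  "path_equiv \<Pi> \<Pi>' \<longleftrightarrow> support \<Pi> = support \<Pi>'"

text \<open>This relation is only meant for non-empty node sets (it holds vacuously if one of them is
  empty); the node set of a path is always non-empty.\<close>

definition node_prec :: "node set \<Rightarrow> node set \<Rightarrow> bool" (infix "\<prec>" 50) where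
  "D1 \<prec> D2 \<longleftrightarrow>
     (\<forall>a1 b1 a2 b2. (a1, b1) \<in> D1 \<and> (a2, b2) \<in> D2 \<and> a1 \<le> a2 \<longrightarrow> b1 < b2)"

definition ordered_k_path :: "node set \<Rightarrow> nat \<Rightarrow> node list list \<Rightarrow> bool" where
  "ordered_k_path D k \<Pi> \<longleftrightarrow> k_path D k \<Pi> \<and>
     (\<forall>i j. i < j \<and> j < k \<longrightarrow> set (\<Pi> ! i) \<prec> set (\<Pi> ! j))"

end

theory Submission
  imports Defs
begin

text \<open>Call \<open>v\<close> weakly southwest of \<open>u\<close> if it lies weakly below and weakly to the left of \<open>u\<close>, and
  strictly southwest if moreover its column is different. Two distinct nodes can occur in a common
  path iff neither is strictly southwest of the other, so the non-empty finite antichains of the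
  strict order are precisely the node sets of paths. On the other hand, \<open>A \<prec> B\<close> says that no node of \<open>B\<close> is
  weakly southwest of a node of \<open>A\<close>. The two orders differ on pairs of nodes in the same column.

  Every path meets a chain of the strict order in at most one node, so the support of a \<open>k\<close>-path has
  at least \<open>k\<close> nodes and all its chains have at most \<open>k\<close> nodes. These two properties alone suffice
  (\<open>ordered_k_path_if_chains_bounded\<close>), by induction on \<open>k\<close> in the manner of Mirsky's theorem: the
  minimal nodes of the strict order form a path that precedes the set of all other nodes, and
  removing all of them shortens every longest chain. If that would leave fewer than \<open>k - 1\<close> nodes,
  only some of the minimal nodes are removed, so that exactly \<open>k - 1\<close> nodes remain; the chains among
  these trivially have at most \<open>k - 1\<close> nodes. The removed nodes are taken closed under moving weakly
  southwest (\<open>sw_upclosed_between\<close>), so that they still precede the remaining ones.\<close>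


section \<open>The southwest orders\<close>

text \<open>\<open>sw v u\<close>: the node \<open>v\<close> lies weakly southwest of \<open>u\<close>. Row indices grow downwards.\<close>

definition sw :: "node \<Rightarrow> node \<Rightarrow> bool" where
  "sw v u \<longleftrightarrow> fst u \<le> fst v \<and> snd v \<le> snd u"

text \<open>\<open>ssw v u\<close>: moreover \<open>v\<close> lies in a column strictly to the left of \<open>u\<close>; the two nodes may share
  a row.\<close>

definition ssw :: "node \<Rightarrow> node \<Rightarrow> bool" where
  "ssw v u \<longleftrightarrow> fst u \<le> fst v \<and> snd v < snd u"

text \<open>A set of nodes that is totally ordered by \<open>ssw\<close>; it meets each path at most once.\<close>

definition ssw_chain :: "node set \<Rightarrow> bool" where
  "ssw_chain C \<longleftrightarrow> (\<forall>u\<in>C. \<forall>v\<in>C. u \<noteq> v \<longrightarrow> ssw u v \<or> ssw v u)"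

text \<open>The nodes of \<open>A\<close> that are minimal for \<open>ssw\<close>, a node to the southwest being the smaller one.\<close>

definition ssw_minimals :: "node set \<Rightarrow> node set" where
  "ssw_minimals A = {u \<in> A. \<forall>v\<in>A. \<not> ssw v u}"

text \<open>\<open>T\<close> is closed, within \<open>S\<close>, under passing to nodes weakly northeast.\<close>

definition sw_upclosed :: "node set \<Rightarrow> node set \<Rightarrow> bool" where
  "sw_upclosed S T \<longleftrightarrow> (\<forall>u\<in>T. \<forall>v\<in>S. sw u v \<longrightarrow> v \<in> T)"

lemma node_prec_iff_sw: "A \<prec> B \<longleftrightarrow> (\<forall>u\<in>A. \<forall>v\<in>B. \<not> sw v u)"
  by (fastforce simp: node_prec_def sw_def)

lemma ex_sw_minimal:
  assumes "finite A" "A \<noteq> {}"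
  obtains u where "u \<in> A" "\<And>v. v \<in> A \<Longrightarrow> sw v u \<Longrightarrow> v = u"
proof -
  \<comment> \<open>Moving southwest strictly increases the row index minus the column index.\<close>
  let ?h = "\<lambda>u :: node. fst u - snd u"
  have "Max (?h ` A) \<in> ?h ` A"
    using assms by simp
  then obtain u where u: "u \<in> A" "?h u = Max (?h ` A)"
    by auto
  have "v = u" if "v \<in> A" "sw v u" for v
  proof -
    have "?h v \<le> ?h u"
      using u(2) that(1) assms(1) by simp
    then show ?thesis
      using that(2) by (auto simp: sw_def prod_eq_iff)
  qed
  then show thesis
    using that u(1) by blast
qed

lemma ssw_minimals_nonempty:
  assumes "finite A" "A \<noteq> {}"
  shows "ssw_minimals A \<noteq> {}"
proof -
  obtain u where "u \<in> A" "\<And>v. v \<in> A \<Longrightarrow> sw v u \<Longrightarrow> v = u"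
    using ex_sw_minimal[OF assms] by blast
  then have "u \<in> ssw_minimals A"
    by (force simp: ssw_minimals_def ssw_def sw_def)
  then show ?thesis
    by blast
qed

lemma sw_upclosed_minus_ssw_minimals: "sw_upclosed S (S - ssw_minimals S)"
  by (force simp: sw_upclosed_def ssw_minimals_def ssw_def sw_def)

lemma sw_upclosed_between:
  assumes "finite S" "A \<subseteq> S" "sw_upclosed S A" "card A \<le> n" "n \<le> card S"
  shows "\<exists>T. A \<subseteq> T \<and> T \<subseteq> S \<and> card T = n \<and> sw_upclosed S T"
  using assms
proof (induction S rule: finite_psubset_induct)
  case (psubset S)
  show ?case
  proof (cases "n = card S")
    case True
    then show ?thesis
      using psubset.prems by (intro exI[of _ S]) (auto simp: sw_upclosed_def)
  next
    case False
    then have "A \<noteq> S"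
      using psubset.prems by auto
    then have "finite (S - A)" "S - A \<noteq> {}"
      using psubset by auto
    then obtain c where c: "c \<in> S - A" "\<And>v. v \<in> S - A \<Longrightarrow> sw v c \<Longrightarrow> v = c"
      using ex_sw_minimal by metis
    have "n \<le> card (S - {c})"
      using False psubset.prems c(1) psubset.hyps by simp
    then obtain T where T: "A \<subseteq> T" "T \<subseteq> S - {c}" "card T = n" "sw_upclosed (S - {c}) T"
      using psubset.IH[of "S - {c}"] psubset.prems c(1) by (auto simp: sw_upclosed_def)
    \<comment> \<open>As \<open>A\<close> is closed, \<open>c\<close> is minimal in the whole of \<open>S\<close>.\<close>
    have "\<not> sw u c" if "u \<in> T" for u
      using that T(2) c psubset.prems(2) unfolding sw_upclosed_def by blast
    then have "sw_upclosed S T"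
      using T(4) by (auto simp: sw_upclosed_def)
    then show ?thesis
      using T by blast
  qed
qed

text \<open>A chain avoiding the minimal nodes can be extended by one node below its least element.\<close>

lemma card_ssw_chain_minus_minimals:
  assumes "finite S" and bound: "\<And>C. C \<subseteq> S \<Longrightarrow> ssw_chain C \<Longrightarrow> card C \<le> Suc k"
    and C: "C \<subseteq> S - ssw_minimals S" "ssw_chain C"
  shows "card C \<le> k"
proof (cases "C = {}")
  case False
  have fin: "finite C"
    using C(1) assms(1) by (meson Diff_subset finite_subset)
  obtain c where c: "c \<in> C" "\<And>v. v \<in> C \<Longrightarrow> \<not> ssw v c"
    using ssw_minimals_nonempty[OF fin False] by (auto simp: ssw_minimals_def)
  obtain v where v: "v \<in> S" "ssw v c"
    using c(1) C(1) unfolding ssw_minimals_def by blast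
  have least: "u = c \<or> ssw c u" if "u \<in> C" for u
    using C(2) c that by (metis ssw_chain_def)
  have "ssw v u" if "u \<in> C" for u
    using least[OF that] v(2) by (auto simp: ssw_def)
  then have "ssw_chain (insert v C)"
    using C(2) by (auto simp: ssw_chain_def)
  moreover have "insert v C \<subseteq> S"
    using v(1) C(1) by auto
  moreover have "v \<notin> C"
    using c(2) v by blast
  ultimately show ?thesis
    using bound[of "insert v C"] fin by simp
qed simp


section \<open>Paths as antichains\<close>

text \<open>Distinct nodes of an antichain lie in distinct rows, so they can be listed by increasing row
  index.\<close>

lemma is_path_of_ssw_antichain:
  assumes "finite A" "A \<noteq> {}" "A \<subseteq> D"
    and anti: "\<And>u v. u \<in> A \<Longrightarrow> v \<in> A \<Longrightarrow> \<not> ssw v u"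
  obtains p where "is_path D p" "set p = A"
proof -
  obtain xs where xs: "set xs = A" "distinct xs"
    using finite_distinct_list[OF assms(1)] by blast
  define p where "p = sort_key fst xs"
  have p: "set p = A" "distinct p" "sorted (map fst p)"
    using xs by (auto simp: p_def)
  have "fst (p ! i) < fst (p ! Suc i) \<and> snd (p ! i) \<le> snd (p ! Suc i)" if "Suc i < length p" for i
  proof -
    have mem: "p ! i \<in> A" "p ! Suc i \<in> A"
      using that p(1) by auto
    have "p ! i \<noteq> p ! Suc i"
      using that p(2) by (simp add: nth_eq_iff_index_eq)
    moreover have "\<not> ssw (p ! Suc i) (p ! i)" "\<not> ssw (p ! i) (p ! Suc i)"
      using anti mem by blast+
    moreover have "fst (p ! i) \<le> fst (p ! Suc i)"
      using sorted_nth_mono[OF p(3), of i "Suc i"] that by simp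
    ultimately show ?thesis
      by (auto simp: ssw_def prod_eq_iff)
  qed
  then have "is_path D p"
    using p(1) assms by (auto simp: is_path_def)
  then show thesis
    using that p(1) by blast
qed

lemma is_path_ssw_antichain:
  assumes p: "is_path D p" and uv: "u \<in> set p" "v \<in> set p"
  shows "\<not> ssw v u"
proof -
  have step: "fst (p ! i) < fst (p ! Suc i)" "snd (p ! i) \<le> snd (p ! Suc i)"
    if "Suc i < length p" for i
    using p that by (auto simp: is_path_def)
  have mono: "fst (p ! i) < fst (p ! j) \<and> snd (p ! i) \<le> snd (p ! j)"
    if "i < j" "j < length p" for i j
    using that
  proof (induction j)
    case (Suc j)
    have "fst (p ! i) \<le> fst (p ! j) \<and> snd (p ! i) \<le> snd (p ! j)"
      using Suc by (cases "i = j") auto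
    then show ?case
      using step[OF Suc.prems(2)] by linarith
  qed simp
  obtain i j where ij: "i < length p" "u = p ! i" "j < length p" "v = p ! j"
    using uv by (metis in_set_conv_nth)
  consider "i < j" | "i = j" | "j < i"
    by linarith
  then show ?thesis
    using mono[of i j] mono[of j i] ij by cases (auto simp: ssw_def)
qed

lemma nth_subset_support: "i < length \<Pi> \<Longrightarrow> set (\<Pi> ! i) \<subseteq> support \<Pi>"
  unfolding support_def by (meson UN_upper nth_mem)

lemma card_ssw_chain_le:
  assumes \<Pi>: "k_path D k \<Pi>" and C: "C \<subseteq> support \<Pi>" "ssw_chain C"
  shows "card C \<le> k"
proof -
  have "\<exists>i<k. u \<in> set (\<Pi> ! i)" if u: "u \<in> C" for u
  proof -
    obtain p where "p \<in> set \<Pi>" "u \<in> set p"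
      using u C(1) unfolding support_def by blast
    then show ?thesis
      using \<Pi> by (metis in_set_conv_nth k_path_def)
  qed
  then obtain f where f: "\<And>u. u \<in> C \<Longrightarrow> f u < k \<and> u \<in> set (\<Pi> ! f u)"
    by metis
  have "inj_on f C"
  proof (rule inj_onI, rule ccontr)
    fix u v assume uv: "u \<in> C" "v \<in> C" "f u = f v" "u \<noteq> v"
    have path: "is_path D (\<Pi> ! f u)"
      using \<Pi> f[OF uv(1)] by (auto simp: k_path_def)
    have "ssw u v \<or> ssw v u"
      using C(2) uv by (auto simp: ssw_chain_def)
    then show False
      using is_path_ssw_antichain[OF path] f uv by metis
  qed
  then have "card C \<le> card {..<k}"
    using f by (intro card_inj_on_le) auto
  then show ?thesis
    by simp
qed

lemma le_card_support:
  assumes \<Pi>: "k_path D k \<Pi>"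
  shows "k \<le> card (support \<Pi>)"
proof -
  have hd: "hd (\<Pi> ! i) \<in> set (\<Pi> ! i)" if "i < k" for i
    using \<Pi> that by (auto simp: k_path_def is_path_def)
  have disj: "set (\<Pi> ! i) \<inter> set (\<Pi> ! j) = {}" if "i < j" "j < k" for i j
    using \<Pi> that by (auto simp: k_path_def)
  have "inj_on (\<lambda>i. hd (\<Pi> ! i)) {..<k}"
  proof (rule linorder_inj_onI)
    fix i j assume "i < j" "i \<in> {..<k}" "j \<in> {..<k}"
    then show "hd (\<Pi> ! i) \<noteq> hd (\<Pi> ! j)"
      using hd[of i] hd[of j] disj[of i j] by auto
  qed auto
  moreover have "(\<lambda>i. hd (\<Pi> ! i)) ` {..<k} \<subseteq> support \<Pi>"
    using hd nth_subset_support \<Pi> by (fastforce simp: k_path_def)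
  moreover have "finite (support \<Pi>)"
    by (simp add: support_def)
  ultimately have "card {..<k} \<le> card (support \<Pi>)"
    by (rule card_inj_on_le)
  then show ?thesis
    by simp
qed


section \<open>Existence of ordered paths\<close>

lemma ordered_k_path_Cons:
  assumes p: "is_path D p" and \<Pi>: "ordered_k_path D k \<Pi>"
    and disj: "set p \<inter> support \<Pi> = {}" and prec: "set p \<prec> support \<Pi>"
  shows "ordered_k_path D (Suc k) (p # \<Pi>)"
proof -
  have len: "length \<Pi> = k"
    using \<Pi> by (simp add: ordered_k_path_def k_path_def)
  have sub: "set (\<Pi> ! j) \<subseteq> support \<Pi>" if "j < k" for j
    using that len by (simp add: nth_subset_support)
  have "set ((p # \<Pi>) ! i) \<inter> set ((p # \<Pi>) ! j) = {} \<and> set ((p # \<Pi>) ! i) \<prec> set ((p # \<Pi>) ! j)"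
    if ij: "i < j" "j < Suc k" for i j
  proof -
    obtain j' where j': "j = Suc j'" "j' < k"
      using ij by (cases j) auto
    show ?thesis
    proof (cases i)
      case 0
      have "set p \<inter> set (\<Pi> ! j') = {}" "set p \<prec> set (\<Pi> ! j')"
        using sub[OF j'(2)] disj prec by (auto simp: node_prec_iff_sw)
      then show ?thesis
        using 0 j'(1) by simp
    next
      case (Suc i')
      then show ?thesis
        using \<Pi> ij j' by (simp add: ordered_k_path_def k_path_def)
    qed
  qed
  then show ?thesis
    using p \<Pi> by (simp add: ordered_k_path_def k_path_def)
qed

lemma ordered_k_path_if_chains_bounded:
  assumes "finite S" "S \<subseteq> D" "k \<le> card S"
    and "\<And>C. C \<subseteq> S \<Longrightarrow> ssw_chain C \<Longrightarrow> card C \<le> k"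
  shows "\<exists>\<Pi>. ordered_k_path D k \<Pi> \<and> support \<Pi> = S"
  using assms
proof (induction k arbitrary: S)
  case 0
  have "S = {}"
  proof (rule ccontr)
    assume "S \<noteq> {}"
    then obtain u where "u \<in> S"
      by blast
    then show False
      using "0.prems"(4)[of "{u}"] by (simp add: ssw_chain_def)
  qed
  then have "ordered_k_path D 0 [] \<and> support [] = S"
    by (simp add: ordered_k_path_def k_path_def support_def)
  then show ?case
    by blast
next
  case (Suc k)
  let ?M = "ssw_minimals S"
  have S: "finite S" "Suc k \<le> card S"
    using Suc.prems by auto
  have MS: "?M \<subseteq> S"
    by (auto simp: ssw_minimals_def)
  \<comment> \<open>The set of nodes left for the remaining paths.\<close>
  obtain T where T: "S - ?M \<subseteq> T" "T \<subset> S" "k \<le> card T" "sw_upclosed S T"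
    and chains: "\<And>C. C \<subseteq> T \<Longrightarrow> ssw_chain C \<Longrightarrow> card C \<le> k"
  proof (cases "k \<le> card (S - ?M)")
    case True
    have "?M \<noteq> {}"
      using S by (intro ssw_minimals_nonempty) auto
    then have "S - ?M \<subset> S"
      using MS by auto
    then show ?thesis
      using that[of "S - ?M"] True sw_upclosed_minus_ssw_minimals
        card_ssw_chain_minus_minimals[OF S(1) Suc.prems(4)] by blast
  next
    case False
    then obtain T where T: "S - ?M \<subseteq> T" "T \<subseteq> S" "card T = k" "sw_upclosed S T"
      using sw_upclosed_between[OF S(1) _ sw_upclosed_minus_ssw_minimals, of k] S by auto
    then have "T \<noteq> S"
      using S(2) by auto
    moreover have "card C \<le> k" if "C \<subseteq> T" for C
      using that T S(1) by (metis card_mono finite_subset)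
    ultimately show ?thesis
      using that[of T] T by blast
  qed
  obtain p where p: "is_path D p" "set p = S - T"
  proof (rule is_path_of_ssw_antichain)
    show "finite (S - T)" "S - T \<noteq> {}" "S - T \<subseteq> D"
      using S(1) T(2) Suc.prems(2) by auto
    show "\<not> ssw v u" if "u \<in> S - T" "v \<in> S - T" for u v
      using that T(1) by (auto simp: ssw_minimals_def)
  qed auto
  have "finite T" "T \<subseteq> D"
    using T(2) S(1) Suc.prems(2) by (auto intro: finite_subset)
  then obtain \<Pi> where \<Pi>: "ordered_k_path D k \<Pi>" "support \<Pi> = T"
    using Suc.IH[of T] T(3) chains by blast
  have "set p \<prec> support \<Pi>"
    using T(4) p(2) \<Pi>(2) by (auto simp: node_prec_iff_sw sw_upclosed_def)
  then have "ordered_k_path D (Suc k) (p # \<Pi>)"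
    using ordered_k_path_Cons[OF p(1) \<Pi>(1)] p(2) \<Pi>(2) by blast
  moreover have "support (p # \<Pi>) = S"
    using p(2) \<Pi>(2) T(2) by (auto simp: support_def)
  ultimately show ?case
    by blast
qed

theorem theorem3p13:
  fixes D :: "node set" and k :: nat and \<Pi> :: "node list list"
  assumes "k \<ge> 1"
    and "diagram D"
    and "k_path D k \<Pi>"
  shows "\<exists>\<Pi>'. ordered_k_path D k \<Pi>' \<and> path_equiv \<Pi> \<Pi>'"
proof -
  have "finite (support \<Pi>)"
    by (simp add: support_def)
  moreover have "support \<Pi> \<subseteq> D"
    using assms(3) by (auto simp: support_def k_path_def is_path_def)
  ultimately have "\<exists>\<Pi>'. ordered_k_path D k \<Pi>' \<and> support \<Pi>' = support \<Pi>"
    using le_card_support[OF assms(3)] card_ssw_chain_le[OF assms(3)]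
    by (intro ordered_k_path_if_chains_bounded)
  then show ?thesis
    by (auto simp: path_equiv_def)
qed

end
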